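(* For each positive integer $n$, let $c(n,5)$ be the maximum of $c(T,5)$ over all tournaments $T$ on $n$ vertices, where $c(T,5)$ is the number of directed 5-cycles in $T$. Then $c(n,5)$ is asymptotically equal to $\frac{3}{4}\binom{n}{5}$, that is, $$\lim_{n\to\infty} \frac{c(n,5)}{\frac{3}{4}\binom{n}{5}} = 1.$$
   Context: A tournament on $n$ vertices (an $n$-tournament) is a directed graph $T=(V,E)$ with $|V|=n$, without loops, such that for every pair of distinct vertices $u,v$ exactly one of $(u,v),(v,u)$ lies in $E$. The quantity $c(T,k)$ is the number of directed $k$-cycles of $T$, counted as subgraphs (i.e. cyclic rotations of the same vertex sequence give the same cycle). The number $\frac34\binom n5$ is the expected number of directed 5-cycles in a uniformly random tournament on $n$ labeled vertices (each edge oriented independently with probability $\frac12$ each way). *)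

theory Defs
  imports Complex_Main "Graph_Theory.Graph_Theory"
begin

locale tournament = pair_digraph +
  assumes exactly_one_arc:
    "u \<in> pverts G \<Longrightarrow> v \<in> pverts G \<Longrightarrow> u \<noteq> v \<Longrightarrow>
      ((u, v) \<in> parcs G) \<noteq> ((v, u) \<in> parcs G)"

text \<open>A directed cycle, as a subgraph, is determined by its set of arcs: the cyclic arc walks
  tracing the same subgraph are exactly those with the same arc set, and they are the cyclic
  rotations of one another.\<close>

definition dicycles :: "'a pair_pre_digraph \<Rightarrow> nat \<Rightarrow> ('a \<times> 'a) set set" where
  "dicycles T k = {set p | p. pre_digraph.cycle (with_proj T) p \<and> length p = k}"

definition num_dicycles :: "'a pair_pre_digraph \<Rightarrow> nat \<Rightarrow> nat" where
  "num_dicycles T k = card (dicycles T k)"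

text \<open>Vertices are taken to be natural numbers; every finite tournament is isomorphic to such
  a one.\<close>

definition max_dicycles :: "nat \<Rightarrow> nat \<Rightarrow> nat" where
  "max_dicycles n k =
    Max {num_dicycles T k | T :: nat pair_pre_digraph. tournament T \<and> card (pverts T) = n}"

text \<open>The maximum is over a finite nonempty set.\<close>

lemma (in tournament) num_dicycles_le: "num_dicycles G k \<le> 2 ^ card (pverts G) ^ 2"
proof -
  have "set p \<subseteq> pverts G \<times> pverts G" if "pre_digraph.cycle (with_proj G) p" for p
    using that by (auto simp: pre_digraph.cycle_def pre_digraph.awalk_def
        dest: in_arcsD1 in_arcsD2)
  then have "dicycles G k \<subseteq> Pow (pverts G \<times> pverts G)"
    unfolding dicycles_def by blast
  then have "card (dicycles G k) \<le> card (Pow (pverts G \<times> pverts G))"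
    by (intro card_mono) (auto simp: pair_finite_verts)
  also have "\<dots> = 2 ^ card (pverts G) ^ 2"
    by (simp add: card_Pow card_cartesian_product pair_finite_verts power2_eq_square)
  finally show ?thesis
    by (simp add: num_dicycles_def)
qed

lemma max_dicycles_finite:
  "finite {num_dicycles T k | T :: nat pair_pre_digraph. tournament T \<and> card (pverts T) = n}"
  by (rule finite_subset[of _ "{..2 ^ n ^ 2}"]) (auto dest: tournament.num_dicycles_le)

lemma max_dicycles_nonempty:
  "{num_dicycles T k | T :: nat pair_pre_digraph. tournament T \<and> card (pverts T) = n} \<noteq> {}"
proof -
  let ?T = "\<lparr>pverts = {..<n}, parcs = {(i, j). i < j \<and> j < n}\<rparr> :: nat pair_pre_digraph"
  have "finite {(i, j). i < j \<and> j < n}"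
    by (rule finite_subset[of _ "{..<n} \<times> {..<n}"]) auto
  then have "tournament ?T"
    by unfold_locales auto
  then show ?thesis
    by force
qed

end

theory Submission
  imports Defs "HOL-Analysis.Convex" "HOL-Real_Asymp.Real_Asymp"
begin

text \<open>Every closed walk of length 5 in a tournament is a cycle, since otherwise it would split off
  a closed walk of length at most 2. Hence the number of 5-cycles is a fifth of the trace of
  \<open>A\<^sup>5\<close>, \<open>A\<close> the adjacency matrix. Up to its diagonal, \<open>A\<close> is \<open>(J + S) / 2\<close> with
  \<open>J\<close> the all-ones matrix and \<open>S\<close> skew with entries \<open>0, 1, -1\<close>. Expanding,
  the words with an odd number of factors \<open>S\<close> vanish, and with \<open>r = S 1\<close> the vector of score
  differences, the trace of \<open>(J + S)\<^sup>5\<close> is \<open>n\<^sup>5 - 5 n\<^sup>2 |r|\<^sup>2 + 5 |S r|\<^sup>2\<close>.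
  By Cauchy-Schwarz \<open>|S r| \<le> n |r|\<close>, so the trace is at most \<open>n\<^sup>5\<close>, with near equality
  for tournaments that are almost regular.\<close>

section \<open>Traces of products of five matrices\<close>

text \<open>The trace of the product of five matrices indexed by \<open>V\<close>. The factors are
  separate arguments so that the trace is linear in each and expands word by word.\<close>

definition closed_walk_sum ::
  "'a set \<Rightarrow> ('a \<Rightarrow> 'a \<Rightarrow> real) \<Rightarrow> ('a \<Rightarrow> 'a \<Rightarrow> real) \<Rightarrow> ('a \<Rightarrow> 'a \<Rightarrow> real) \<Rightarrow>
    ('a \<Rightarrow> 'a \<Rightarrow> real) \<Rightarrow> ('a \<Rightarrow> 'a \<Rightarrow> real) \<Rightarrow> real" where
  "closed_walk_sum V k1 k2 k3 k4 k5 =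
    (\<Sum>a\<in>V. \<Sum>b\<in>V. \<Sum>c\<in>V. \<Sum>d\<in>V. \<Sum>e\<in>V. k1 a b * k2 b c * k3 c d * k4 d e * k5 e a)"

lemma sum5_rotate:
  fixes F :: "'a \<Rightarrow> 'a \<Rightarrow> 'a \<Rightarrow> 'a \<Rightarrow> 'a \<Rightarrow> 'b::comm_monoid_add"
  shows "(\<Sum>a\<in>V. \<Sum>b\<in>V. \<Sum>c\<in>V. \<Sum>d\<in>V. \<Sum>e\<in>V. F a b c d e) =
    (\<Sum>b\<in>V. \<Sum>c\<in>V. \<Sum>d\<in>V. \<Sum>e\<in>V. \<Sum>a\<in>V. F a b c d e)"
proof -
  have "(\<Sum>a\<in>V. \<Sum>b\<in>V. \<Sum>c\<in>V. \<Sum>d\<in>V. \<Sum>e\<in>V. F a b c d e) =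
      (\<Sum>b\<in>V. \<Sum>a\<in>V. \<Sum>c\<in>V. \<Sum>d\<in>V. \<Sum>e\<in>V. F a b c d e)"
    by (rule sum.swap)
  also have "\<dots> = (\<Sum>b\<in>V. \<Sum>c\<in>V. \<Sum>a\<in>V. \<Sum>d\<in>V. \<Sum>e\<in>V. F a b c d e)"
    by (intro sum.cong refl sum.swap)
  also have "\<dots> = (\<Sum>b\<in>V. \<Sum>c\<in>V. \<Sum>d\<in>V. \<Sum>a\<in>V. \<Sum>e\<in>V. F a b c d e)"
    by (rule sum.cong[OF refl], rule sum.cong[OF refl], rule sum.swap)
  also have "\<dots> = (\<Sum>b\<in>V. \<Sum>c\<in>V. \<Sum>d\<in>V. \<Sum>e\<in>V. \<Sum>a\<in>V. F a b c d e)"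
    by (rule sum.cong[OF refl], rule sum.cong[OF refl], rule sum.cong[OF refl], rule sum.swap)
  finally show ?thesis .
qed

lemma sum5_reverse:
  fixes F :: "'a \<Rightarrow> 'a \<Rightarrow> 'a \<Rightarrow> 'a \<Rightarrow> 'a \<Rightarrow> 'b::comm_monoid_add"
  shows "(\<Sum>a\<in>V. \<Sum>b\<in>V. \<Sum>c\<in>V. \<Sum>d\<in>V. \<Sum>e\<in>V. F a b c d e) =
    (\<Sum>e\<in>V. \<Sum>d\<in>V. \<Sum>c\<in>V. \<Sum>b\<in>V. \<Sum>a\<in>V. F a b c d e)"
proof -
  \<comment> \<open>Four reversals of three adjacent sums, at positions 1-3, 3-5, 2-4 and 1-3,
    reverse all five.\<close>
  have swap3: "(\<Sum>a\<in>V. \<Sum>b\<in>V. \<Sum>c\<in>V. G a b c) = (\<Sum>c\<in>V. \<Sum>b\<in>V. \<Sum>a\<in>V. G a b c)"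
    for G :: "'a \<Rightarrow> 'a \<Rightarrow> 'a \<Rightarrow> 'b"
    by (subst sum.swap, subst (2) sum.swap, subst sum.swap, rule refl)
  have "(\<Sum>a\<in>V. \<Sum>b\<in>V. \<Sum>c\<in>V. \<Sum>d\<in>V. \<Sum>e\<in>V. F a b c d e) =
      (\<Sum>c\<in>V. \<Sum>b\<in>V. \<Sum>a\<in>V. \<Sum>d\<in>V. \<Sum>e\<in>V. F a b c d e)"
    by (rule swap3)
  also have "\<dots> = (\<Sum>c\<in>V. \<Sum>b\<in>V. \<Sum>e\<in>V. \<Sum>d\<in>V. \<Sum>a\<in>V. F a b c d e)"
    by (rule sum.cong[OF refl], rule sum.cong[OF refl], rule swap3)
  also have "\<dots> = (\<Sum>c\<in>V. \<Sum>d\<in>V. \<Sum>e\<in>V. \<Sum>b\<in>V. \<Sum>a\<in>V. F a b c d e)"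
    by (rule sum.cong[OF refl], rule swap3)
  also have "\<dots> = (\<Sum>e\<in>V. \<Sum>d\<in>V. \<Sum>c\<in>V. \<Sum>b\<in>V. \<Sum>a\<in>V. F a b c d e)"
    by (rule swap3)
  finally show ?thesis .
qed

lemma closed_walk_sum_rotate:
  "closed_walk_sum V k1 k2 k3 k4 k5 = closed_walk_sum V k2 k3 k4 k5 k1"
  unfolding closed_walk_sum_def by (subst sum5_rotate) (simp add: ac_simps)

lemma closed_walk_sum_rotations:
  assumes "closed_walk_sum V k1 k2 k3 k4 k5 = x"
  shows "closed_walk_sum V k1 k2 k3 k4 k5 = x" "closed_walk_sum V k2 k3 k4 k5 k1 = x"
    "closed_walk_sum V k3 k4 k5 k1 k2 = x" "closed_walk_sum V k4 k5 k1 k2 k3 = x"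
    "closed_walk_sum V k5 k1 k2 k3 k4 = x"
  using assms closed_walk_sum_rotate by metis+

text \<open>Invariance of the trace under transposition: the closed walk is traversed
  backwards.\<close>

lemma closed_walk_sum_reverse:
  "closed_walk_sum V k1 k2 k3 k4 k5 =
    closed_walk_sum V (\<lambda>x y. k5 y x) (\<lambda>x y. k4 y x) (\<lambda>x y. k3 y x) (\<lambda>x y. k2 y x) (\<lambda>x y. k1 y x)"
proof -
  have "closed_walk_sum V k1 k2 k3 k4 k5 =
      (\<Sum>e\<in>V. \<Sum>d\<in>V. \<Sum>c\<in>V. \<Sum>b\<in>V. \<Sum>a\<in>V. k1 a b * k2 b c * k3 c d * k4 d e * k5 e a)"
    unfolding closed_walk_sum_def by (rule sum5_reverse)
  also have "\<dots> = (\<Sum>a\<in>V. \<Sum>e\<in>V. \<Sum>d\<in>V. \<Sum>c\<in>V. \<Sum>b\<in>V. k1 a b * k2 b c * k3 c d * k4 d e * k5 e a)"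
    by (rule sum5_rotate[symmetric])
  finally show ?thesis
    by (simp add: closed_walk_sum_def ac_simps)
qed

lemma closed_walk_sum_add:
  "closed_walk_sum V (\<lambda>x y. f x y + g x y) k2 k3 k4 k5 =
    closed_walk_sum V f k2 k3 k4 k5 + closed_walk_sum V g k2 k3 k4 k5"
  "closed_walk_sum V k1 (\<lambda>x y. f x y + g x y) k3 k4 k5 =
    closed_walk_sum V k1 f k3 k4 k5 + closed_walk_sum V k1 g k3 k4 k5"
  "closed_walk_sum V k1 k2 (\<lambda>x y. f x y + g x y) k4 k5 =
    closed_walk_sum V k1 k2 f k4 k5 + closed_walk_sum V k1 k2 g k4 k5"
  "closed_walk_sum V k1 k2 k3 (\<lambda>x y. f x y + g x y) k5 =
    closed_walk_sum V k1 k2 k3 f k5 + closed_walk_sum V k1 k2 k3 g k5"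
  "closed_walk_sum V k1 k2 k3 k4 (\<lambda>x y. f x y + g x y) =
    closed_walk_sum V k1 k2 k3 k4 f + closed_walk_sum V k1 k2 k3 k4 g"
  by (simp_all add: closed_walk_sum_def distrib_left distrib_right sum.distrib)

lemma closed_walk_sum_uminus:
  "closed_walk_sum V (\<lambda>x y. - f x y) k2 k3 k4 k5 = - closed_walk_sum V f k2 k3 k4 k5"
  "closed_walk_sum V k1 (\<lambda>x y. - f x y) k3 k4 k5 = - closed_walk_sum V k1 f k3 k4 k5"
  "closed_walk_sum V k1 k2 (\<lambda>x y. - f x y) k4 k5 = - closed_walk_sum V k1 k2 f k4 k5"
  "closed_walk_sum V k1 k2 k3 (\<lambda>x y. - f x y) k5 = - closed_walk_sum V k1 k2 k3 f k5"
  "closed_walk_sum V k1 k2 k3 k4 (\<lambda>x y. - f x y) = - closed_walk_sum V k1 k2 k3 k4 f"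
  by (simp_all add: closed_walk_sum_def sum_negf)

text \<open>The 32 words in \<open>J\<close> and \<open>s\<close> fall into eight classes under
  cyclic rotation, and the trace is constant on each class. It is evaluated on one representative
  per class.\<close>

lemma closed_walk_sum_one_plus_skew:
  fixes s :: "'a \<Rightarrow> 'a \<Rightarrow> real" and V :: "'a set"
  assumes skew: "\<And>x y. s y x = - s x y"
  defines "B \<equiv> \<lambda>x y. 1 + s x y"
  defines "r \<equiv> \<lambda>x. \<Sum>y\<in>V. s x y"
  shows "closed_walk_sum V B B B B B =
    real (card V) ^ 5 - 5 * real (card V) ^ 2 * (\<Sum>x\<in>V. (r x)\<^sup>2)
      + 5 * (\<Sum>x\<in>V. (\<Sum>y\<in>V. s x y * r y)\<^sup>2)"
proof -
  define J :: "'a \<Rightarrow> 'a \<Rightarrow> real" where "J = (\<lambda>x y. 1)"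
  let ?T = "closed_walk_sum V" and ?n = "real (card V)"
  have B: "B = (\<lambda>x y. J x y + s x y)"
    by (simp add: B_def J_def)
  have Jt: "(\<lambda>x y. J y x) = J"
    by (simp add: J_def)
  have st: "(\<lambda>x y. s y x) = (\<lambda>x y. - s x y)"
    using skew by blast
  note rev = closed_walk_sum_reverse Jt st closed_walk_sum_uminus
  have col: "(\<Sum>x\<in>V. s x y) = - r y" for y
    unfolding r_def sum_negf[symmetric] by (rule sum.cong[OF refl]) (rule skew)
  have total: "(\<Sum>x\<in>V. r x) = 0"
  proof -
    have "(\<Sum>x\<in>V. r x) = (\<Sum>y\<in>V. \<Sum>x\<in>V. s x y)"
      unfolding r_def by (rule sum.swap)
    then show ?thesis
      by (simp add: col sum_negf)
  qed
  have t0: "?T J J J J J = ?n ^ 5"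
    by (simp add: closed_walk_sum_def J_def power_numeral_reduce)
  \<comment> \<open>Transposition costs one sign per factor \<open>s\<close>. If their number is odd
    and the reversed word is a rotation of the original, the trace equals its own negative. The same
    argument gives \<open>t3\<close>, \<open>t3'\<close> and \<open>t5\<close>.\<close>
  have "?T s J J J J = - ?T J J J J s"
    by (subst rev(1)) (simp only: rev(2-))
  then have t1: "?T s J J J J = 0"
    using closed_walk_sum_rotate[of V s J J J J] by simp
  have "?T s s s J J = - ?T J J s s s"
    by (subst rev(1)) (simp only: rev(2-) minus_minus)
  then have t3: "?T s s s J J = 0"
    using closed_walk_sum_rotations(4)[of V s s s J J, OF refl] by simp
  have "?T s s J s J = - ?T J s J s s"
    by (subst rev(1)) (simp only: rev(2-) minus_minus)
  then have t3': "?T s s J s J = 0"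
    using closed_walk_sum_rotations(3,5)[of V s s J s J, OF refl] by simp
  have "?T s s s s s = - ?T s s s s s"
    by (subst rev(1)) (simp only: rev(2-) minus_minus)
  then have t5: "?T s s s s s = 0"
    by simp
  \<comment> \<open>With 1 the all-ones vector, this trace is n^2 times 1^T S^2 1, and skewness
    turns 1^T S^2 1 into -|S 1|^2.\<close>
  have "?T J s s J J = ?n ^ 2 * (\<Sum>b\<in>V. \<Sum>c\<in>V. \<Sum>d\<in>V. s b c * s c d)"
    by (simp add: closed_walk_sum_def J_def sum_distrib_left power2_eq_square mult.assoc)
  also have "(\<Sum>b\<in>V. \<Sum>c\<in>V. \<Sum>d\<in>V. s b c * s c d) = (\<Sum>b\<in>V. \<Sum>c\<in>V. s b c * r c)"
    by (simp add: r_def sum_distrib_left)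
  also have "\<dots> = (\<Sum>c\<in>V. (\<Sum>b\<in>V. s b c) * r c)"
    by (subst sum.swap) (simp add: sum_distrib_right)
  also have "\<dots> = - (\<Sum>c\<in>V. (r c)\<^sup>2)"
    by (simp add: col sum_negf power2_eq_square)
  finally have t2: "?T J s s J J = - (?n ^ 2 * (\<Sum>c\<in>V. (r c)\<^sup>2))"
    by simp
  \<comment> \<open>A factor \<open>s\<close> between two factors \<open>J\<close> splits off 1^T S
    1, the sum of all \<open>r c\<close>, which vanishes.\<close>
  have "?T s J s J J = ?n * (\<Sum>a\<in>V. \<Sum>b\<in>V. s a b * (\<Sum>c\<in>V. r c))"
    by (simp add: closed_walk_sum_def J_def r_def sum_distrib_left ac_simps)
  then have t2': "?T s J s J J = 0"
    by (simp add: total)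
  \<comment> \<open>Since S^2 is symmetric, 1^T S^4 1 = |S^2 1|^2 = |S r|^2. The swaps below move
    the middle vertex \<open>d\<close> of the walk outermost, where the two halves factor.\<close>
  have "?T J s s s s = (\<Sum>a\<in>V. \<Sum>b\<in>V. \<Sum>c\<in>V. \<Sum>d\<in>V. \<Sum>e\<in>V. s b c * s c d * s d e * s e a)"
    by (simp add: closed_walk_sum_def J_def)
  also have "\<dots> = (\<Sum>b\<in>V. \<Sum>c\<in>V. \<Sum>d\<in>V. \<Sum>e\<in>V. \<Sum>a\<in>V. s b c * s c d * s d e * s e a)"
    by (rule sum5_rotate)
  also have "\<dots> = (\<Sum>b\<in>V. \<Sum>c\<in>V. \<Sum>d\<in>V. s b c * s c d * (\<Sum>e\<in>V. s d e * r e))"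
    by (simp add: r_def sum_distrib_left mult.assoc)
  also have "\<dots> = (\<Sum>b\<in>V. \<Sum>d\<in>V. \<Sum>c\<in>V. s b c * s c d * (\<Sum>e\<in>V. s d e * r e))"
    by (rule sum.cong[OF refl], rule sum.swap)
  also have "\<dots> = (\<Sum>d\<in>V. \<Sum>b\<in>V. \<Sum>c\<in>V. s b c * s c d * (\<Sum>e\<in>V. s d e * r e))"
    by (rule sum.swap)
  also have "\<dots> = (\<Sum>d\<in>V. \<Sum>c\<in>V. \<Sum>b\<in>V. s b c * s c d * (\<Sum>e\<in>V. s d e * r e))"
    by (rule sum.cong[OF refl], rule sum.swap)
  also have "\<dots> = (\<Sum>d\<in>V. (\<Sum>c\<in>V. (\<Sum>b\<in>V. s b c) * s c d) * (\<Sum>e\<in>V. s d e * r e))"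
    by (simp add: sum_distrib_right)
  also have "\<dots> = (\<Sum>d\<in>V. (\<Sum>y\<in>V. s d y * r y)\<^sup>2)"
  proof (rule sum.cong[OF refl])
    fix d
    have "(\<Sum>c\<in>V. (\<Sum>b\<in>V. s b c) * s c d) = (\<Sum>y\<in>V. s d y * r y)"
      unfolding col by (rule sum.cong[OF refl]) (subst skew, simp)
    then show "(\<Sum>c\<in>V. (\<Sum>b\<in>V. s b c) * s c d) * (\<Sum>e\<in>V. s d e * r e) = (\<Sum>y\<in>V. s d y * r y)\<^sup>2"
      by (simp add: power2_eq_square)
  qed
  finally have t4: "?T J s s s s = (\<Sum>d\<in>V. (\<Sum>y\<in>V. s d y * r y)\<^sup>2)" .
  note words = t0 t5 closed_walk_sum_rotations[OF t1] closed_walk_sum_rotations[OF t2]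
    closed_walk_sum_rotations[OF t2'] closed_walk_sum_rotations[OF t3]
    closed_walk_sum_rotations[OF t3'] closed_walk_sum_rotations[OF t4]
  show ?thesis
    unfolding B by (simp only: closed_walk_sum_add words)
qed

text \<open>Cauchy-Schwarz row by row: there are \<open>card V\<close> rows, each of squared norm at
  most \<open>card V\<close>. Hence the negative term of the trace formula absorbs the positive
  one.\<close>

lemma sum_square_mult_le:
  fixes s :: "'a \<Rightarrow> 'a \<Rightarrow> real"
  assumes bound: "\<And>x y. \<bar>s x y\<bar> \<le> 1"
  shows "(\<Sum>x\<in>V. (\<Sum>y\<in>V. s x y * r y)\<^sup>2) \<le> real (card V) ^ 2 * (\<Sum>x\<in>V. (r x)\<^sup>2)"
proof -
  have "(\<Sum>y\<in>V. s x y * r y)\<^sup>2 \<le> real (card V) * (\<Sum>y\<in>V. (r y)\<^sup>2)" for x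
  proof -
    have "(\<Sum>y\<in>V. s x y * r y)\<^sup>2 \<le> (\<Sum>y\<in>V. (s x y)\<^sup>2) * (\<Sum>y\<in>V. (r y)\<^sup>2)"
      by (rule Cauchy_Schwarz_ineq_sum)
    also have "\<dots> \<le> real (card V) * (\<Sum>y\<in>V. (r y)\<^sup>2)"
      using bound sum_bounded_above[of V "\<lambda>y. (s x y)\<^sup>2" 1]
      by (intro mult_right_mono sum_nonneg) (auto simp: abs_square_le_1)
    finally show ?thesis .
  qed
  then have "(\<Sum>x\<in>V. (\<Sum>y\<in>V. s x y * r y)\<^sup>2) \<le> (\<Sum>x\<in>V. real (card V) * (\<Sum>y\<in>V. (r y)\<^sup>2))"
    by (rule sum_mono)
  then show ?thesis
    by (simp add: power2_eq_square mult.assoc)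
qed

section \<open>Five-cycles as closed walks\<close>

definition pentagon :: "'a \<times> 'a \<times> 'a \<times> 'a \<times> 'a \<Rightarrow> ('a \<times> 'a) set" where
  "pentagon = (\<lambda>(a, b, c, d, e). {(a, b), (b, c), (c, d), (d, e), (e, a)})"

text \<open>The arc set fixes the successor of each of the five vertices, so a tuple with this arc
  set is determined by its first entry, for which there are five choices.\<close>

lemma card_same_pentagon:
  assumes "distinct [a, b, c, d, e]"
  shows "card {t. pentagon t = pentagon (a, b, c, d, e)} = 5"
proof -
  have "{t. pentagon t = pentagon (a, b, c, d, e)} =
      {(a, b, c, d, e), (b, c, d, e, a), (c, d, e, a, b), (d, e, a, b, c), (e, a, b, c, d)}"
    (is "?L = ?R")
  proof
    show "?R \<subseteq> ?L"
      by (auto simp: pentagon_def)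
    show "?L \<subseteq> ?R"
    proof
      fix t
      assume "t \<in> ?L"
      moreover obtain a' b' c' d' e' where t: "t = (a', b', c', d', e')"
        by (cases t)
      ultimately have eq: "{(a', b'), (b', c'), (c', d'), (d', e'), (e', a')} =
          {(a, b), (b, c), (c, d), (d, e), (e, a)}"
        by (simp add: pentagon_def)
      \<comment> \<open>The last branch serves \<open>x = e\<close> and closes the cycle at
        \<open>a\<close>.\<close>
      define succ where
        "succ x = (if x = a then b else if x = b then c else if x = c then d else if x = d then e else a)"
        for x
      have succ_simps: "succ a = b" "succ b = c" "succ c = d" "succ d = e" "succ e = a"
        using assms by (auto simp: succ_def)
      then have succ: "y = succ x" if "(x, y) \<in> {(a, b), (b, c), (c, d), (d, e), (e, a)}" for x y
        using that by auto
      have "(a', b') \<in> {(a, b), (b, c), (c, d), (d, e), (e, a)}"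
        unfolding eq[symmetric] by (intro insertI1)
      then have "a' = a \<or> a' = b \<or> a' = c \<or> a' = d \<or> a' = e"
        by blast
      moreover have "b' = succ a'" "c' = succ b'" "d' = succ c'" "e' = succ d'"
        by (intro succ, unfold eq[symmetric], blast)+
      ultimately show "t \<in> ?R"
        by (elim disjE) (simp_all add: t succ_simps)
    qed
  qed
  then show ?thesis
    using assms by simp
qed

context tournament
begin

definition closed_walks5 :: "('a \<times> 'a \<times> 'a \<times> 'a \<times> 'a) set" where
  "closed_walks5 = {t. pentagon t \<subseteq> parcs G}"

lemma arc_antisym: "(u, v) \<in> parcs G \<Longrightarrow> (v, u) \<notin> parcs G"
  using exactly_one_arc[of u v] pair_no_loops[of "(u, v)"] in_arcsD1 in_arcsD2 by force

lemma arc_irrefl: "(u, u) \<notin> parcs G"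
  using arc_antisym by blast

text \<open>Two positions on a closed walk of length 5 have cyclic distance 1 or 2, so a repeated
  vertex would give a loop or a pair of opposite arcs.\<close>

lemma closed_walks5_distinct:
  assumes "(a, b, c, d, e) \<in> closed_walks5"
  shows "distinct [a, b, c, d, e]"
  using assms arc_antisym arc_irrefl by (auto simp: closed_walks5_def pentagon_def)

lemma dicycles_5: "dicycles G 5 = pentagon ` closed_walks5"
proof
  show "dicycles G 5 \<subseteq> pentagon ` closed_walks5"
  proof
    fix C
    assume "C \<in> dicycles G 5"
    then obtain p u where p: "set p \<subseteq> parcs G" "pcas u p u" "length p = 5" "C = set p"
      by (auto simp: dicycles_def pre_digraph.cycle_def pre_digraph.awalk_def)
    then obtain a b c d e where "p = [(a, b), (b, c), (c, d), (d, e), (e, a)]"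
      by (auto simp: numeral_eq_Suc length_Suc_conv)
    with p have "C = pentagon (a, b, c, d, e)" "(a, b, c, d, e) \<in> closed_walks5"
      by (auto simp: pentagon_def closed_walks5_def)
    then show "C \<in> pentagon ` closed_walks5"
      by blast
  qed
  show "pentagon ` closed_walks5 \<subseteq> dicycles G 5"
  proof
    fix C
    assume "C \<in> pentagon ` closed_walks5"
    then obtain a b c d e where t: "(a, b, c, d, e) \<in> closed_walks5" "C = pentagon (a, b, c, d, e)"
      by auto
    let ?p = "[(a, b), (b, c), (c, d), (d, e), (e, a)]"
    have "cycle ?p"
      using t(1) closed_walks5_distinct[OF t(1)] in_arcsD1[of a b]
      by (auto simp: cycle_def awalk_def closed_walks5_def pentagon_def)
    moreover have "C = set ?p"
      by (simp add: t(2) pentagon_def)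
    ultimately show "C \<in> dicycles G 5"
      unfolding dicycles_def by (intro CollectI exI[of _ ?p]) simp
  qed
qed

lemma closed_walks5_subset:
  "closed_walks5 \<subseteq> pverts G \<times> pverts G \<times> pverts G \<times> pverts G \<times> pverts G"
  using in_arcsD1 by (auto simp: closed_walks5_def pentagon_def)

text \<open>Double counting along the fibres of \<open>pentagon\<close>.\<close>

lemma card_closed_walks5: "card closed_walks5 = 5 * num_dicycles G 5"
proof -
  have fin: "finite closed_walks5"
    by (rule finite_subset[OF closed_walks5_subset]) (simp add: pair_finite_verts)
  have "card {t \<in> closed_walks5. pentagon t = C} = 5" if "C \<in> pentagon ` closed_walks5" for C
  proof -
    from that obtain a b c d e
      where t: "(a, b, c, d, e) \<in> closed_walks5" "C = pentagon (a, b, c, d, e)"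
      by auto
    \<comment> \<open>Membership in \<open>closed_walks5\<close> depends on
      \<open>pentagon t\<close> alone, so the whole fibre lies inside.\<close>
    have "{t \<in> closed_walks5. pentagon t = C} = {t. pentagon t = pentagon (a, b, c, d, e)}"
      using t by (auto simp: closed_walks5_def)
    then show ?thesis
      using card_same_pentagon[OF closed_walks5_distinct[OF t(1)]] by simp
  qed
  then have "(\<Sum>C\<in>pentagon ` closed_walks5. \<Sum>t\<in>{t \<in> closed_walks5. pentagon t = C}. 1) =
      (\<Sum>C\<in>pentagon ` closed_walks5. 5 :: nat)"
    by simp
  then show ?thesis
    using sum.image_gen[OF fin, of "\<lambda>_. 1::nat" pentagon] by (simp add: num_dicycles_def dicycles_5)
qed

section \<open>The adjacency matrix and the bounds on the number of 5-cycles\<close>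

definition arc_ind :: "'a \<Rightarrow> 'a \<Rightarrow> real" where
  "arc_ind u v = of_bool ((u, v) \<in> parcs G)"

text \<open>The skew matrix S; its row sums are out-degree minus in-degree.\<close>

definition arc_sign :: "'a \<Rightarrow> 'a \<Rightarrow> real" where
  "arc_sign u v = arc_ind u v - arc_ind v u"

lemma arc_sign_skew: "arc_sign v u = - arc_sign u v"
  by (simp add: arc_sign_def)

text \<open>A product of five arc indicators is the indicator of a closed walk, and each cycle has
  five starting points.\<close>

lemma closed_walk_sum_arc_ind:
  "closed_walk_sum (pverts G) arc_ind arc_ind arc_ind arc_ind arc_ind = 5 * real (num_dicycles G 5)"
proof -
  let ?V = "pverts G"
  have "real (card closed_walks5) =
      (\<Sum>t\<in>?V \<times> ?V \<times> ?V \<times> ?V \<times> ?V. of_bool (t \<in> closed_walks5))"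
    using closed_walks5_subset by (simp add: pair_finite_verts Int_absorb1)
  also have "\<dots> = closed_walk_sum ?V arc_ind arc_ind arc_ind arc_ind arc_ind"
    by (simp add: closed_walk_sum_def sum.cartesian_product' arc_ind_def closed_walks5_def
        pentagon_def of_bool_conj[symmetric] conj_assoc)
  finally show ?thesis
    by (simp add: card_closed_walks5)
qed

text \<open>In matrix form, (J + S) / 2 = A + I / 2, because the sign is 0 on the diagonal.\<close>

lemma half_one_plus_arc_sign:
  assumes "u \<in> pverts G" "v \<in> pverts G"
  shows "(1 + arc_sign u v) / 2 = (if u = v then 1 / 2 else arc_ind u v)"
  using exactly_one_arc[OF assms] by (auto simp: arc_sign_def arc_ind_def)

lemma closed_walk_sum_arc_sign:
  defines "M \<equiv> \<lambda>u v. (1 + arc_sign u v) / 2"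
  defines "r \<equiv> \<lambda>u. \<Sum>v\<in>pverts G. arc_sign u v"
  shows "32 * closed_walk_sum (pverts G) M M M M M =
    real (card (pverts G)) ^ 5 - 5 * real (card (pverts G)) ^ 2 * (\<Sum>u\<in>pverts G. (r u)\<^sup>2)
      + 5 * (\<Sum>u\<in>pverts G. (\<Sum>v\<in>pverts G. arc_sign u v * r v)\<^sup>2)"
proof -
  let ?B = "\<lambda>u v. 1 + arc_sign u v"
  have "32 * closed_walk_sum (pverts G) M M M M M = closed_walk_sum (pverts G) ?B ?B ?B ?B ?B"
    by (simp add: closed_walk_sum_def M_def sum_distrib_left)
  then show ?thesis
    unfolding r_def using closed_walk_sum_one_plus_skew[OF arc_sign_skew, where V = "pverts G"] by simp
qed

text \<open>Raising the diagonal of A from 0 to 1/2 can only increase the trace. The constant is 160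
  = 2^5 * 5, from the halves and the five starting points.\<close>

lemma num_dicycles_5_upper: "real (num_dicycles G 5) \<le> real (card (pverts G)) ^ 5 / 160"
proof -
  let ?V = "pverts G" and ?M = "\<lambda>u v. (1 + arc_sign u v) / 2"
  have le: "0 \<le> arc_ind u v \<and> arc_ind u v \<le> ?M u v" if "u \<in> ?V" "v \<in> ?V" for u v
    using half_one_plus_arc_sign[OF that] arc_irrefl[of u] by (auto simp: arc_ind_def)
  have "5 * real (num_dicycles G 5) \<le> closed_walk_sum ?V ?M ?M ?M ?M ?M"
    unfolding closed_walk_sum_arc_ind[symmetric] closed_walk_sum_def
    by (intro sum_mono mult_mono mult_nonneg_nonneg) (use le order_trans in blast)+
  \<comment> \<open>The two terms in the row sums add up to at most 0 by
    \<open>sum_square_mult_le\<close>.\<close>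
  also have "32 * \<dots> \<le> real (card ?V) ^ 5"
    unfolding closed_walk_sum_arc_sign
    using sum_square_mult_le[where s = arc_sign and V = ?V and r = "\<lambda>u. \<Sum>v\<in>?V. arc_sign u v"]
    by (simp add: arc_sign_def arc_ind_def)
  finally show ?thesis
    by simp
qed

text \<open>Row sums in [-1, 1] cost at most 5 n^3 in the trace formula. The diagonal entries 1/2
  matter for at most 5 n^4 tuples, each contributing at most 1, which gives n^4 after division by
  5.\<close>

lemma num_dicycles_5_lower:
  assumes "\<And>u. u \<in> pverts G \<Longrightarrow> \<bar>\<Sum>v\<in>pverts G. arc_sign u v\<bar> \<le> 1"
  defines "n \<equiv> real (card (pverts G))"
  shows "real (num_dicycles G 5) \<ge> (n ^ 5 - 5 * n ^ 3) / 160 - n ^ 4"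
proof -
  let ?V = "pverts G" and ?M = "\<lambda>u v. (1 + arc_sign u v) / 2"
  let ?r = "\<lambda>u. \<Sum>v\<in>?V. arc_sign u v"
  have M: "?M u v = (if u = v then 1 / 2 else arc_ind u v)" if "u \<in> ?V" "v \<in> ?V" for u v
    using half_one_plus_arc_sign[OF that] .
  have M01: "0 \<le> ?M u v \<and> ?M u v \<le> 1" for u v
    by (auto simp: arc_sign_def arc_ind_def)
  \<comment> \<open>If two cyclically adjacent vertices coincide, the product is at most 1 and one
    of the indicators pays for it; otherwise the two products agree.\<close>
  have pointwise: "?M a b * ?M b c * ?M c d * ?M d e * ?M e a
      \<le> arc_ind a b * arc_ind b c * arc_ind c d * arc_ind d e * arc_ind e a
        + of_bool (a = b) + of_bool (b = c) + of_bool (c = d) + of_bool (d = e) + of_bool (e = a)"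
    if "a \<in> ?V" "b \<in> ?V" "c \<in> ?V" "d \<in> ?V" "e \<in> ?V" for a b c d e
  proof (cases "a = b \<or> b = c \<or> c = d \<or> d = e \<or> e = a")
    case True
    have "?M a b * ?M b c * ?M c d * ?M d e * ?M e a \<le> 1"
      using M01 by (intro mult_le_one mult_nonneg_nonneg) auto
    also have "1 \<le> of_bool (a = b) + of_bool (b = c) + of_bool (c = d) + of_bool (d = e) + (of_bool (e = a) :: real)"
      using True by auto
    also have "\<dots> \<le> arc_ind a b * arc_ind b c * arc_ind c d * arc_ind d e * arc_ind e a + \<dots>"
      by (simp add: arc_ind_def)
    finally show ?thesis
      by (simp add: add.assoc)
  next
    case False
    then show ?thesis
      using that by (simp add: M)
  qed
  \<comment> \<open>Each coincidence leaves four free vertices, hence n^4 tuples.\<close>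
  have loops: "(\<Sum>a\<in>?V. \<Sum>b\<in>?V. \<Sum>c\<in>?V. \<Sum>d\<in>?V. \<Sum>e\<in>?V.
      arc_ind a b * arc_ind b c * arc_ind c d * arc_ind d e * arc_ind e a
        + of_bool (a = b) + of_bool (b = c) + of_bool (c = d) + of_bool (d = e) + of_bool (e = a))
      = 5 * real (num_dicycles G 5) + 5 * n ^ 4"
    unfolding closed_walk_sum_arc_ind[symmetric] closed_walk_sum_def
    by (simp add: sum.distrib pair_finite_verts of_bool_def sum.delta n_def power_numeral_reduce
        flip: sum_distrib_left)
  have "(\<Sum>u\<in>?V. (?r u)\<^sup>2) \<le> n"
    using sum_mono[of ?V "\<lambda>u. (?r u)\<^sup>2" "\<lambda>_. 1"] assms(1) by (simp add: abs_square_le_1 n_def)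
  then have "n ^ 2 * (\<Sum>u\<in>?V. (?r u)\<^sup>2) \<le> n ^ 2 * n"
    by (rule mult_left_mono) simp
  moreover have "0 \<le> (\<Sum>u\<in>?V. (\<Sum>v\<in>?V. arc_sign u v * ?r v)\<^sup>2)"
    by (intro sum_nonneg) simp
  ultimately have "n ^ 5 - 5 * n ^ 3 \<le> 32 * closed_walk_sum ?V ?M ?M ?M ?M ?M"
    unfolding closed_walk_sum_arc_sign n_def[symmetric] by (simp add: power_numeral_reduce)
  also have "closed_walk_sum ?V ?M ?M ?M ?M ?M \<le> 5 * real (num_dicycles G 5) + 5 * n ^ 4"
    unfolding closed_walk_sum_def loops[symmetric] by (intro sum_mono pointwise)
  finally show ?thesis
    by (simp add: field_simps)
qed

end

section \<open>An almost regular tournament of every order\<close>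

text \<open>Row \<open>i\<close> of the sign matrix alternates once its diagonal zero is skipped,
  with -1 at \<open>i - 1\<close> and 1 at \<open>i + 1\<close>. So the row sums stay in {-1, 0, 1}
  for even \<open>n\<close> as well, where no tournament is exactly regular.\<close>

definition alternating_tournament :: "nat \<Rightarrow> nat pair_pre_digraph" where
  "alternating_tournament n = \<lparr>pverts = {..<n},
    parcs = {(i, j). i < n \<and> j < n \<and> (i < j \<and> odd (i + j) \<or> j < i \<and> even (i + j))}\<rparr>"

lemma tournament_alternating: "tournament (alternating_tournament n)"
proof -
  have "finite (parcs (alternating_tournament n))"
    by (rule finite_subset[of _ "{..<n} \<times> {..<n}"]) (auto simp: alternating_tournament_def)
  then show ?thesis
    by unfold_locales (auto simp: alternating_tournament_def)
qed

lemma alternating_tournament_arc_sign_sum: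
  assumes "i < n"
  shows "\<bar>\<Sum>j\<in>pverts (alternating_tournament n).
    tournament.arc_sign (alternating_tournament n) i j\<bar> \<le> 1"
proof -
  interpret tournament "alternating_tournament n"
    by (rule tournament_alternating)
  let ?f = "\<lambda>j. if j = i then 0 else if i < j then - ((- 1) ^ (i + j)) else (- 1) ^ (i + j) :: real"
  \<comment> \<open>For \<open>m > i\<close> the entries left of \<open>i\<close> contribute -1 or 0
    by the parity of \<open>i\<close>; those right of it start with 1 and contribute 0 or 1.\<close>
  have partial: "sum ?f {..<m} = (if m \<le> i then (- 1) ^ i * of_bool (odd m)
      else of_bool (odd i) * -1 + of_bool (odd (m - Suc i)))" for m
  proof (induction m)
    case (Suc m)
    then show ?case
      by (cases "m < i"; cases "m = i") (auto simp: not_less Suc_diff_le power_add)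
  qed simp
  have "(\<Sum>j\<in>pverts (alternating_tournament n). arc_sign i j) = sum ?f {..<n}"
    unfolding arc_sign_def arc_ind_def using assms
    by (intro sum.cong) (auto simp: alternating_tournament_def add.commute)
  then show ?thesis
    using partial[of n] assms by (auto simp: abs_if)
qed

section \<open>Asymptotics of the maximum\<close>

lemma max_dicycles_5_le: "real (max_dicycles n 5) \<le> real n ^ 5 / 160"
proof -
  have "max_dicycles n 5 \<in> {num_dicycles T 5 | T :: nat pair_pre_digraph. tournament T \<and> card (pverts T) = n}"
    unfolding max_dicycles_def by (rule Max_in[OF max_dicycles_finite max_dicycles_nonempty])
  then show ?thesis
    using tournament.num_dicycles_5_upper by force
qed

lemma max_dicycles_5_ge: "real (max_dicycles n 5) \<ge> (real n ^ 5 - 5 * real n ^ 3) / 160 - real n ^ 4"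
proof -
  interpret tournament "alternating_tournament n"
    by (rule tournament_alternating)
  have V: "pverts (alternating_tournament n) = {..<n}"
    by (simp add: alternating_tournament_def)
  have "(real n ^ 5 - 5 * real n ^ 3) / 160 - real n ^ 4 \<le> real (num_dicycles (alternating_tournament n) 5)"
    using num_dicycles_5_lower alternating_tournament_arc_sign_sum[where n = n] by (simp add: V)
  also have "num_dicycles (alternating_tournament n) 5 \<le> max_dicycles n 5"
    unfolding max_dicycles_def
    using tournament_alternating V by (intro Max_ge[OF max_dicycles_finite]) force
  finally show ?thesis
    by simp
qed

lemma real_choose_5:
  "real (n choose 5) = real n * (real n - 1) * (real n - 2) * (real n - 3) * (real n - 4) / 120"
  by (simp add: binomial_gbinomial gbinomial_prod_rev numeral_eq_Suc fact_numeral)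

theorem mainTheorem4:
  shows "(\<lambda>n. real (max_dicycles n 5) / (3 / 4 * real (n choose 5))) \<longlonglongrightarrow> 1"
proof (rule tendsto_sandwich)
  let ?l = "\<lambda>n. ((real n ^ 5 - 5 * real n ^ 3) / 160 - real n ^ 4) / (3 / 4 * real (n choose 5))"
  let ?u = "\<lambda>n. (real n ^ 5 / 160) / (3 / 4 * real (n choose 5))"
  \<comment> \<open>Both numerators and the denominator have leading term n^5 / 160, as (3/4) / 120
    = 1 / 160.\<close>
  show "?l \<longlonglongrightarrow> 1"
    unfolding real_choose_5 by real_asymp
  show "?u \<longlonglongrightarrow> 1"
    unfolding real_choose_5 by real_asymp
  \<comment> \<open>For \<open>n < 5\<close> the denominator is 0 and every quotient is 0 by
    convention, so the comparison holds for all \<open>n\<close>.\<close>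
  show "\<forall>\<^sub>F n in sequentially. ?l n \<le> real (max_dicycles n 5) / (3 / 4 * real (n choose 5))"
    by (intro always_eventually allI divide_right_mono max_dicycles_5_ge) simp
  show "\<forall>\<^sub>F n in sequentially. real (max_dicycles n 5) / (3 / 4 * real (n choose 5)) \<le> ?u n"
    by (intro always_eventually allI divide_right_mono max_dicycles_5_le) simp
qed

end
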